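(* Fix $\ell \ge 4$, $\tau > 0$ and a constant $A \ge 2\ell$, and set $\alpha := 3/4$ and $\beta := \min\bigl\{\frac{1-\alpha}{2(A+2)}, \frac{\alpha}{80\ell}\bigr\}$. Consider the high-girth triple-process on $[n]$ with parameter $\ell$ and let $m_0 := \lceil (1-n^{-\beta}) n^2/6\rceil$. Let $\mathcal T$ be the collection of all pairs $(G,H)$ of $3$-uniform hypergraphs with $\max\{v_H, e_H\} \le 2\ell$ and $G \subset H$. Let $\mathcal C_i$ be the event that for all $(G,H) \in \mathcal T$ and all injections $\rho : V(G) \to [n]$, $$N_{\rho,G,H}(i) \le n^{\alpha/9} \cdot \max_{G \subseteq J \subseteq H} n^{(v_H - e_H) + (e_J - v_J)}.$$ Then $\Pr(\neg \mathcal C_i \cap \mathcal G_i \text{ for some } 0 \le i \le m_0) = o(n^{-\tau})$ as $n \to \infty$.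
   Context: For a $3$-uniform hypergraph $F$, $v_F, e_F$ denote its numbers of vertices and triples. $\mathfrak F^+$ is the collection (up to isomorphism) of $3$-uniform hypergraphs $F$ with $4 \le v_F \le \ell$, $e_F = v_F - 2$, and no subhypergraph $J \subsetneq F$ with $v_J \ge 4$, $e_J = v_J - 2$; $\mathfrak F \subseteq \mathfrak F^+$ consists of those with $v_F \ge 6$. High-girth triple-process: $\mathcal H_0$ is empty on $[n]$; a triple $xyz$ is available at step $i$ if it meets every triple of $\mathcal H_i$ in at most one vertex and $\mathcal H_i + xyz$ contains no copy of a hypergraph in $\mathfrak F$; $e_{i+1}$ is uniform among available triples and $\mathcal H_{i+1} := \mathcal H_i + e_{i+1}$; the process stops when no triple is available. $Q(i)$: set of available triples at step $i$; $E(i)$: pairs of $[n]$ in no triple of $\mathcal H_i$; $Y_{uv}(i) := \{z : uvz \in Q(i)\}$ for $uv\in E(i)$; for $F \in \mathfrak F$, $\mathbf F_F$ is the set of copies of $F$ in $\binom{[n]}{3}$ and, for $uvw \in Q(i)$ and $0\le k\le e_F-2$, $W_{uvw,F,k}(i)$ is the set of $F' \in \mathbf F_F$ with $uvw \in F'\cap Q(i)$, $|F'\cap Q(i)| = e_F - k$, $|F'\cap\mathcal H_i| = k$. With $t = i/n^2$, $p(t) = 1 - 6t$, $q(t) = \exp\{-\sum_{F\in\mathfrak F}\frac{6e_F}{|\mathrm{Aut}(F)|}(6t)^{e_F-1}\}$, $\hat q = p^3qn^3/6$, $\hat y = p^2qn$, $\hat w_{F,k} = \frac{6e_F}{|\mathrm{Aut}(F)|}\binom{e_F-1}{k}(6t)^k(p^3qn)^{e_F-1-k}$.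 $\mathcal G_i$ is the event that for all $0 \le j \le i$ (with $t = j/n^2$): $|Q(j)| \ge \hat q(t)/2$, $|Q(j)| = \hat q(t) \pm p^{-A}n^\alpha(pn^2)$, $|Y_{uv}(j)| = \hat y(t) \pm p^{-A}n^\alpha$ for all $uv \in E(j)$, and $|W_{uvw,F,k}(j)| = \hat w_{F,k}(t) \pm p^{-A}n^\alpha(p^2n)^{e_F-(2+k)}$ for all $uvw \in Q(j)$, $F \in \mathfrak F$, $0 \le k \le e_F - 2$. For $G \subset H$ and an injection $\rho: V(G)\to[n]$, $N_{\rho,G,H}(i)$ is the number of injections $\psi : V(H) \to [n]$ with $\psi|_{V(G)} = \rho$ and $\psi(H \setminus G) \subseteq \mathcal H_i$ (where $\psi(xyz) = \psi(x)\psi(y)\psi(z)$ and $\psi$ applied to a set of triples is applied triplewise). *)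

theory Defs
  imports
    "HOL-Probability.Probability"
    "HOL-Combinatorics.Permutations"
    "HOL-Library.Landau_Symbols"
begin

type_synonym 'a hypergraph = "'a set \<times> 'a set set"

abbreviation verts :: "'a hypergraph \<Rightarrow> 'a set" where
  "verts \<equiv> fst"

abbreviation triples :: "'a hypergraph \<Rightarrow> 'a set set" where
  "triples \<equiv> snd"

abbreviation v_num :: "'a hypergraph \<Rightarrow> nat" where
  "v_num F \<equiv> card (verts F)"

abbreviation e_num :: "'a hypergraph \<Rightarrow> nat" where
  "e_num F \<equiv> card (triples F)"

definition triples_on :: "'a set \<Rightarrow> 'a set set" where
  "triples_on V = {e. e \<subseteq> V \<and> card e = 3}"

definition uniform3 :: "'a hypergraph \<Rightarrow> bool" where
  "uniform3 F \<longleftrightarrow> finite (verts F) \<and> triples F \<subseteq> triples_on (verts F)"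

definition subhypergraph :: "'a hypergraph \<Rightarrow> 'a hypergraph \<Rightarrow> bool" where
  "subhypergraph J F \<longleftrightarrow>
     uniform3 J \<and> uniform3 F \<and> verts J \<subseteq> verts F \<and> triples J \<subseteq> triples F"

definition isomorphic :: "'a hypergraph \<Rightarrow> 'b hypergraph \<Rightarrow> bool" where
  "isomorphic F F' \<longleftrightarrow>
     (\<exists>f. bij_betw f (verts F) (verts F') \<and> (\<lambda>e. f ` e) ` triples F = triples F')"

definition Aut :: "'a hypergraph \<Rightarrow> ('a \<Rightarrow> 'a) set" where
  "Aut F = {f. f permutes verts F \<and> (\<lambda>e. f ` e) ` triples F = triples F}"

definition minimal_dense :: "nat \<Rightarrow> 'a hypergraph \<Rightarrow> bool" where
  "minimal_dense l F \<longleftrightarrow>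
     uniform3 F \<and> 4 \<le> v_num F \<and> v_num F \<le> l \<and> e_num F = v_num F - 2 \<and>
     \<not> (\<exists>J. subhypergraph J F \<and> J \<noteq> F \<and> 4 \<le> v_num J \<and> e_num J = v_num J - 2)"

text \<open>One representative of every isomorphism class, so that sums over the family
  count each hypergraph once up to isomorphism.\<close>

definition family_plus :: "nat \<Rightarrow> nat hypergraph set" where
  "family_plus l =
     (\<lambda>C. SOME F. F \<in> C) ` ({F. minimal_dense l F} // {(F, F'). isomorphic F F'})"

definition family :: "nat \<Rightarrow> nat hypergraph set" where
  "family l = {F \<in> family_plus l. 6 \<le> v_num F}"

definition injections :: "'a set \<Rightarrow> 'b set \<Rightarrow> ('a \<Rightarrow> 'b) set" where
  "injections X Y = {f \<in> X \<rightarrow>\<^sub>E Y. inj_on f X}"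

text \<open>A copy is recorded by its set of triples; members of the family have no isolated
  vertices, so nothing is lost.\<close>

definition copies :: "nat \<Rightarrow> 'a hypergraph \<Rightarrow> nat set set set" where
  "copies n F = {(\<lambda>e. \<psi> ` e) ` triples F | \<psi>. \<psi> \<in> injections (verts F) {1..n}}"

definition available :: "nat \<Rightarrow> nat \<Rightarrow> nat set set \<Rightarrow> nat set set" where
  "available l n H =
     {e \<in> triples_on {1..n}. (\<forall>f\<in>H. card (e \<inter> f) \<le> 1) \<and>
        \<not> (\<exists>F\<in>family l. \<exists>F'\<in>copies n F. F' \<subseteq> insert e H)}"

text \<open>The law of the trajectory \<open>[H\<^sub>0, H\<^sub>1, \<dots>]\<close> after at most the given number of steps.
  The list stops growing when no triple is available, so step \<open>i\<close> of the process exists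
  iff \<open>i\<close> is less than the length of the list.\<close>

primrec triple_process :: "nat \<Rightarrow> nat \<Rightarrow> nat \<Rightarrow> nat set set list pmf" where
  "triple_process l n 0 = return_pmf [{}]"
| "triple_process l n (Suc i) =
     bind_pmf (triple_process l n i) (\<lambda>hs.
       if available l n (last hs) = {} then return_pmf hs
       else map_pmf (\<lambda>e. hs @ [insert e (last hs)]) (pmf_of_set (available l n (last hs))))"

definition open_pairs :: "nat \<Rightarrow> nat set set \<Rightarrow> nat set set" where
  "open_pairs n H = {uv. uv \<subseteq> {1..n} \<and> card uv = 2 \<and> \<not> (\<exists>e\<in>H. uv \<subseteq> e)}"

definition Y_set :: "nat \<Rightarrow> nat \<Rightarrow> nat set set \<Rightarrow> nat set \<Rightarrow> nat set" where
  "Y_set l n H uv = {z. insert z uv \<in> available l n H}"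

definition W_set ::
  "nat \<Rightarrow> nat \<Rightarrow> nat set set \<Rightarrow> nat set \<Rightarrow> nat hypergraph \<Rightarrow> nat \<Rightarrow> nat set set set" where
  "W_set l n H uvw F k =
     {F' \<in> copies n F. uvw \<in> F' \<inter> available l n H \<and>
        card (F' \<inter> available l n H) = e_num F - k \<and> card (F' \<inter> H) = k}"

definition p_fun :: "real \<Rightarrow> real" where
  "p_fun t = 1 - 6 * t"

definition q_fun :: "nat \<Rightarrow> real \<Rightarrow> real" where
  "q_fun l t =
     exp (- (\<Sum>F\<in>family l. 6 * real (e_num F) / real (card (Aut F)) * (6 * t) ^ (e_num F - 1)))"

definition q_hat :: "nat \<Rightarrow> nat \<Rightarrow> real \<Rightarrow> real" where
  "q_hat l n t = p_fun t ^ 3 * q_fun l t * real n ^ 3 / 6"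

definition y_hat :: "nat \<Rightarrow> nat \<Rightarrow> real \<Rightarrow> real" where
  "y_hat l n t = p_fun t ^ 2 * q_fun l t * real n"

definition w_hat :: "nat \<Rightarrow> nat \<Rightarrow> nat hypergraph \<Rightarrow> nat \<Rightarrow> real \<Rightarrow> real" where
  "w_hat l n F k t =
     6 * real (e_num F) / real (card (Aut F)) * real ((e_num F - 1) choose k) * (6 * t) ^ k *
     (p_fun t ^ 3 * q_fun l t * real n) ^ (e_num F - 1 - k)"

definition good_at :: "nat \<Rightarrow> real \<Rightarrow> real \<Rightarrow> nat \<Rightarrow> real \<Rightarrow> nat set set \<Rightarrow> bool" where
  "good_at l A \<alpha> n t H \<longleftrightarrow>
     (let Q = available l n H; p = p_fun t; err = p powr (- A) * real n powr \<alpha> in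
       real (card Q) \<ge> q_hat l n t / 2 \<and>
       \<bar>real (card Q) - q_hat l n t\<bar> \<le> err * (p * real n ^ 2) \<and>
       (\<forall>uv\<in>open_pairs n H. \<bar>real (card (Y_set l n H uv)) - y_hat l n t\<bar> \<le> err) \<and>
       (\<forall>uvw\<in>Q. \<forall>F\<in>family l. \<forall>k\<le>e_num F - 2.
          \<bar>real (card (W_set l n H uvw F k)) - w_hat l n F k t\<bar>
            \<le> err * (p ^ 2 * real n) ^ (e_num F - (2 + k))))"

definition good_event :: "nat \<Rightarrow> real \<Rightarrow> real \<Rightarrow> nat \<Rightarrow> nat \<Rightarrow> nat set set list set" where
  "good_event l A \<alpha> n i =
     {hs. i < length hs \<and> (\<forall>j\<le>i. good_at l A \<alpha> n (real j / real n ^ 2) (hs ! j))}"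

definition extension_count ::
  "nat \<Rightarrow> nat set set \<Rightarrow> ('a \<Rightarrow> nat) \<Rightarrow> 'a hypergraph \<Rightarrow> 'a hypergraph \<Rightarrow> nat" where
  "extension_count n S \<rho> G H =
     card {\<psi> \<in> injections (verts H) {1..n}.
             (\<forall>x\<in>verts G. \<psi> x = \<rho> x) \<and> (\<lambda>e. \<psi> ` e) ` (triples H - triples G) \<subseteq> S}"

definition extension_pairs :: "nat \<Rightarrow> (nat hypergraph \<times> nat hypergraph) set" where
  "extension_pairs l = {(G, H). max (v_num H) (e_num H) \<le> 2 * l \<and> subhypergraph G H}"

definition extension_bounded :: "nat \<Rightarrow> real \<Rightarrow> nat \<Rightarrow> nat set set \<Rightarrow> bool" where
  "extension_bounded l \<alpha> n S \<longleftrightarrow>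
     (\<forall>(G, H)\<in>extension_pairs l. \<forall>\<rho>\<in>injections (verts G) {1..n}.
        real (extension_count n S \<rho> G H) \<le> real n powr (\<alpha> / 9) *
          Max {real n powi ((int (v_num H) - int (e_num H)) + (int (e_num J) - int (v_num J)))
               | J. subhypergraph G J \<and> subhypergraph J H})"

definition extension_event :: "nat \<Rightarrow> real \<Rightarrow> nat \<Rightarrow> nat \<Rightarrow> nat set set list set" where
  "extension_event l \<alpha> n i = {hs. i < length hs \<and> extension_bounded l \<alpha> n (hs ! i)}"

lemma isomorphic_refl: "isomorphic F F"
  unfolding isomorphic_def by (rule exI[of _ id]) auto

lemma isomorphic_sym:
  assumes "uniform3 F" "isomorphic F F'"
  shows "isomorphic F' F"
proof -
  obtain f where f: "bij_betw f (verts F) (verts F')"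
    and t: "(\<lambda>e. f ` e) ` triples F = triples F'"
    using assms(2) unfolding isomorphic_def by blast
  let ?g = "inv_into (verts F) f"
  have "?g ` f ` e = e" if "e \<in> triples F" for e
    using assms(1) that f unfolding uniform3_def triples_on_def
    by (intro inv_into_image_cancel) (auto simp: bij_betw_def)
  then have "(\<lambda>e. ?g ` e) ` triples F' = triples F"
    unfolding t[symmetric] image_image by simp
  then show ?thesis
    unfolding isomorphic_def using bij_betw_inv_into[OF f] by blast
qed

lemma isomorphic_trans:
  assumes "isomorphic F F'" "isomorphic F' F''"
  shows "isomorphic F F''"
proof -
  obtain f where f: "bij_betw f (verts F) (verts F')" "(\<lambda>e. f ` e) ` triples F = triples F'"
    using assms(1) unfolding isomorphic_def by blast
  obtain g where g: "bij_betw g (verts F') (verts F'')" "(\<lambda>e. g ` e) ` triples F' = triples F''"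
    using assms(2) unfolding isomorphic_def by blast
  have "(\<lambda>e. (g \<circ> f) ` e) ` triples F = triples F''"
    unfolding g(2)[symmetric] f(2)[symmetric] by (simp add: image_image)
  then show ?thesis
    unfolding isomorphic_def using bij_betw_trans[OF f(1) g(1)] by blast
qed

lemma image_hypergraph:
  assumes "uniform3 F" "inj_on f (verts F)"
  shows "uniform3 (f ` verts F, (\<lambda>e. f ` e) ` triples F)"
    and "card (f ` verts F) = v_num F"
    and "card ((\<lambda>e. f ` e) ` triples F) = e_num F"
proof -
  have sub: "e \<subseteq> verts F" "card e = 3" if "e \<in> triples F" for e
    using assms(1) that unfolding uniform3_def triples_on_def by auto
  have "card (f ` e) = 3" if "e \<in> triples F" for e
    using sub[OF that] assms(2) card_image inj_on_subset by metis
  then show "uniform3 (f ` verts F, (\<lambda>e. f ` e) ` triples F)"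
    using sub assms(1) unfolding uniform3_def triples_on_def by auto
  show "card (f ` verts F) = v_num F"
    using assms(2) by (rule card_image)
  have "inj_on (\<lambda>e. f ` e) (triples F)"
    using sub(1) assms(2) by (intro inj_onI) (meson inj_on_image_eq_iff)
  then show "card ((\<lambda>e. f ` e) ` triples F) = e_num F"
    by (rule card_image)
qed

lemma minimal_dense_isomorphic:
  assumes "minimal_dense l F" "isomorphic F F'"
  shows "minimal_dense l F'"
proof -
  have u: "uniform3 F" using assms(1) by (simp add: minimal_dense_def)
  obtain f where f: "bij_betw f (verts F) (verts F')" "(\<lambda>e. f ` e) ` triples F = triples F'"
    using assms(2) unfolding isomorphic_def by blast
  have F': "F' = (f ` verts F, (\<lambda>e. f ` e) ` triples F)"
    using f by (auto simp: bij_betw_def prod_eq_iff)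
  have inj: "inj_on f (verts F)" using f by (simp add: bij_betw_def)
  note im = image_hypergraph[OF u inj]
  have u': "uniform3 F'" and card': "v_num F' = v_num F" "e_num F' = e_num F"
    using im unfolding F' by simp_all
  obtain g where g: "bij_betw g (verts F') (verts F)" "(\<lambda>e. g ` e) ` triples F' = triples F"
    using isomorphic_sym[OF u assms(2)] unfolding isomorphic_def by blast
  have False if J: "subhypergraph J F'" "J \<noteq> F'" "4 \<le> v_num J" "e_num J = v_num J - 2" for J
  proof -
    let ?K = "(g ` verts J, (\<lambda>e. g ` e) ` triples J)"
    have uJ: "uniform3 J" and sub: "verts J \<subseteq> verts F'" "triples J \<subseteq> triples F'"
      using J(1) by (auto simp: subhypergraph_def)
    have gi: "inj_on g (verts J)"
      using g(1) sub(1) by (auto simp: bij_betw_def intro: inj_on_subset)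
    note K = image_hypergraph[OF uJ gi]
    have s: "subhypergraph ?K F"
      using K(1) u image_mono[OF sub(1), of g] image_mono[OF sub(2), of "\<lambda>e. g ` e"] g
      by (simp add: subhypergraph_def bij_betw_def)
    have fin: "finite (verts F')" "finite (triples F')"
      using u' finite_subset[of "triples F'" "Pow (verts F')"]
      unfolding uniform3_def triples_on_def by auto
    have "v_num J \<noteq> v_num F' \<or> e_num J \<noteq> e_num F'"
      using J(2) card_subset_eq[OF fin(1) sub(1)] card_subset_eq[OF fin(2) sub(2)]
      by (metis prod.expand)
    then have "?K \<noteq> F"
      using K card' by auto
    then show False
      using s K(2,3) J(3,4) assms(1) unfolding minimal_dense_def
      by (auto dest!: spec[of _ "g ` verts J"])
  qed
  then show ?thesis
    using assms(1) u' card' unfolding minimal_dense_def by auto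
qed

lemma family_plus_sound:
  assumes "F \<in> family_plus l"
  shows "minimal_dense l F"
proof -
  obtain G :: "nat hypergraph" where G: "minimal_dense l G" "F = (SOME F'. isomorphic G F')"
    using assms unfolding family_plus_def quotient_def by auto
  have "isomorphic G F"
    unfolding G(2) by (rule someI[of "isomorphic G" G]) (rule isomorphic_refl)
  then show ?thesis using G(1) by (rule minimal_dense_isomorphic[rotated])
qed

lemma family_plus_complete:
  assumes "minimal_dense l (F :: nat hypergraph)"
  shows "\<exists>!F'. F' \<in> family_plus l \<and> isomorphic F F'"
proof -
  let ?rep = "\<lambda>F :: nat hypergraph. SOME F' :: nat hypergraph. isomorphic F F'"
  have fam: "family_plus l = ?rep ` {F. minimal_dense l (F :: nat hypergraph)}"
    unfolding family_plus_def quotient_def 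
    by (simp add: image_UN Image_def image_image UNION_singleton_eq_range)
  have rep: "isomorphic G (?rep G)" for G :: "nat hypergraph"
    by (rule someI[of "isomorphic G" G]) (rule isomorphic_refl)
  show ?thesis
  proof (intro ex1I[of _ "?rep F"] conjI)
    show "?rep F \<in> family_plus l" using assms fam by blast
    show "isomorphic F (?rep F)" by (rule rep)
    fix F' assume F': "F' \<in> family_plus l \<and> isomorphic F F'"
    then obtain G where G: "minimal_dense l G" "F' = ?rep G" using fam by auto
    have "isomorphic F' G"
      using G rep isomorphic_sym unfolding minimal_dense_def by blast
    then have FG: "isomorphic F G" using F' isomorphic_trans by blast
    then have GF: "isomorphic G F"
      using assms isomorphic_sym unfolding minimal_dense_def by blast
    have "isomorphic F = (isomorphic G :: nat hypergraph \<Rightarrow> bool)"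
      using FG GF isomorphic_trans by (intro ext) blast
    then show "F' = ?rep F" using G by simp
  qed
qed

lemma finite_family: "finite (family l)"
proof -
  let ?S = "Pow {..<l} \<times> Pow (Pow {..<l})"
  have "\<exists>G\<in>?S. isomorphic F G" if F: "F \<in> family_plus l" for F
  proof -
    have m: "minimal_dense l F" using F by (rule family_plus_sound)
    then have u: "uniform3 F" and l: "v_num F \<le> l" by (auto simp: minimal_dense_def)
    obtain f where f: "bij_betw f (verts F) {0..<v_num F}"
      using u ex_bij_betw_finite_nat unfolding uniform3_def by blast
    let ?G = "(f ` verts F, (\<lambda>e. f ` e) ` triples F)"
    have "isomorphic F ?G"
      using f unfolding isomorphic_def by (auto simp: bij_betw_def)
    moreover have V: "f ` verts F \<subseteq> {..<l}"
      using f l by (auto simp: bij_betw_def)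
    moreover have "f ` e \<subseteq> {..<l}" if "e \<in> triples F" for e
      using u that V unfolding uniform3_def triples_on_def by blast
    ultimately show ?thesis by (intro bexI[of _ ?G]) blast+
  qed
  then obtain h where h: "\<And>F. F \<in> family_plus l \<Longrightarrow> h F \<in> ?S \<and> isomorphic F (h F)"
    by metis
  have "inj_on h (family_plus l)"
  proof (rule inj_onI)
    fix F F' assume a: "F \<in> family_plus l" "F' \<in> family_plus l" "h F = h F'"
    have m: "minimal_dense l F" "minimal_dense l F'" using a family_plus_sound by blast+
    have "isomorphic (h F) F'"
      using h[OF a(2)] m(2) a(3) isomorphic_sym unfolding minimal_dense_def by metis
    then have "isomorphic F F'" using h[OF a(1)] isomorphic_trans by blast
    then show "F = F'"
      using family_plus_complete[OF m(1)] a isomorphic_refl by blast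
  qed
  moreover have "h ` family_plus l \<subseteq> ?S"
    using h by blast
  moreover have "finite ?S"
    by (intro finite_cartesian_product finite_Pow_iff[THEN iffD2] finite_lessThan)
  ultimately have "finite (family_plus l)"
    by (rule inj_on_finite)
  then show ?thesis unfolding family_def by simp
qed

end

theory Submission
  imports Defs "HOL-Real_Asymp.Real_Asymp"
begin

text \<open>While the trajectory is good, every step has at least \<open>n\<^sup>3\<^sup>-\<^sup>3\<^sup>\<beta>\<close> available triples up to a constant,
  so a fixed set of \<open>k\<close> triples is ever contained in the process with probability at most
  \<open>x\<^sup>k\<close>, where \<open>x\<close> is of order \<open>n\<^sup>3\<^sup>\<beta>\<^sup>-\<^sup>1\<close>. The \<open>s\<close>-th moment of the number of extensions is therefore at
  most the sum of \<open>x\<close> to the number of triples in the union, over all \<open>s\<close>-tuples of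
  extensions. Adding the extensions one at a time and grouping each new one by its overlap \<open>J\<close>
  with the earlier ones, every extension contributes a factor of at most a constant times
  \<open>n\<^sup>6\<^sup>l\<^sup>\<beta>\<close> times the maximum over \<open>J\<close> in the statement. As \<open>6 l \<beta> < \<alpha> / 9\<close>, Markov's inequality
  with \<open>s\<close> large beats the union bound over the polynomially many \<open>(G, H, \<rho>)\<close>.\<close>

section \<open>Hitting probabilities and the moment method\<close>

lemma prob_bind_pmf:
  "measure_pmf.prob (bind_pmf M N) X = measure_pmf.expectation M (\<lambda>x. measure_pmf.prob (N x) X)"
proof -
  have "ennreal (measure_pmf.prob (bind_pmf M N) X)
      = (\<integral>\<^sup>+x. ennreal (measure_pmf.prob (N x) X) \<partial>M)"
    by (simp add: measure_pmf.emeasure_eq_measure[symmetric])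
  also have "\<dots> = ennreal (measure_pmf.expectation M (\<lambda>x. measure_pmf.prob (N x) X))"
    by (intro nn_integral_eq_integral measure_pmf.integrable_const_bound[where B = 1]) auto
  finally show ?thesis
    by (simp add: integral_nonneg)
qed

lemma finite_available: "finite (available l n H)"
  by (rule finite_subset[of _ "Pow {1..n}"]) (auto simp: available_def triples_on_def)

lemma triple_process_nonempty:
  "hs \<in> set_pmf (triple_process l n m) \<Longrightarrow> hs \<noteq> []"
  by (induction m arbitrary: hs) (auto split: if_splits)

text \<open>Largeness of the set of available triples is demanded only before the step at which
  \<open>T\<close> is contained, so the event persists under all later steps. This does the work of
  a stopping time without changing the process. The condition is a product with \<open>r\<close>,
  which stands for the reciprocal of the required number of triples.\<close>

definition hit_event :: "nat \<Rightarrow> nat \<Rightarrow> real \<Rightarrow> nat set set \<Rightarrow> nat set set list set" where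
  "hit_event l n r T =
     {hs. \<exists>i<length hs. (\<forall>j<i. 1 \<le> r * real (card (available l n (hs ! j)))) \<and> T \<subseteq> hs ! i}"

text \<open>If one more step creates the event, its witness \<open>i\<close> can only be the new
  last index, since an earlier witness would already serve for \<open>hs\<close>. Hence all states
  of \<open>hs\<close> satisfy the largeness condition, and the added triple is the one element of
  \<open>T\<close> that was still missing.\<close>

lemma hit_event_snocD:
  assumes "hs @ [insert e (last hs)] \<in> hit_event l n r T" "hs \<noteq> []" "hs \<notin> hit_event l n r T"
  shows "e \<in> T" "hs \<in> hit_event l n r (T - {e})"
    "1 \<le> r * real (card (available l n (last hs)))"
proof -
  let ?hs = "hs @ [insert e (last hs)]"
  obtain i where i: "i < length ?hs"
    "\<And>j. j < i \<Longrightarrow> 1 \<le> r * real (card (available l n (?hs ! j)))" "T \<subseteq> ?hs ! i"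
    using assms(1) unfolding hit_event_def by blast
  have nth: "?hs ! j = hs ! j" if "j < length hs" for j
    using that by (simp add: nth_append)
  have len: "i = length hs"
  proof (rule ccontr)
    assume "i \<noteq> length hs"
    then have "i < length hs" using i(1) by simp
    then have "hs \<in> hit_event l n r T"
      unfolding hit_event_def using i(2,3) nth by (auto intro!: exI[of _ i])
    then show False using assms(3) by simp
  qed
  have open_steps: "1 \<le> r * real (card (available l n (hs ! j)))" if "j < length hs" for j
    using i(2)[of j] nth[OF that] that len by simp
  have last: "last hs = hs ! (length hs - 1)" "length hs - 1 < length hs"
    using assms(2) by (auto simp: last_conv_nth)
  have T: "T \<subseteq> insert e (last hs)" using i(3) len by simp
  show "1 \<le> r * real (card (available l n (last hs)))"
    using open_steps last by simp
  have sub: "hs \<in> hit_event l n r T'" if "T' \<subseteq> last hs" for T'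
    unfolding hit_event_def using that open_steps last
    by (auto intro!: exI[of _ "length hs - 1"])
  show "hs \<in> hit_event l n r (T - {e})" using T by (intro sub) auto
  show "e \<in> T" using T sub[of T] assms(3) by auto
qed

text \<open>While a step has at least \<open>1 / r\<close> available triples, it picks any given one with
  probability at most \<open>r\<close>; there are at most \<open>m\<close> choices for the step which picks each element
  of \<open>T\<close>.\<close>

lemma prob_hit_event:
  assumes "finite T" "0 \<le> r"
  shows "measure_pmf.prob (triple_process l n m) (hit_event l n r T) \<le> (real m * r) ^ card T"
  using assms(1)
proof (induction m arbitrary: T)
  case 0
  \<comment> \<open>The value \<open>0 ^ card T\<close> covers both cases: it is 1 for empty
    \<open>T\<close>, and otherwise the empty hypergraph does not contain \<open>T\<close>.\<close>
  have "measure_pmf.prob (return_pmf [{}]) (hit_event l n r T) \<le> 0 ^ card T"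
  proof (cases "T = {}")
    case False
    then have "[{}] \<notin> hit_event l n r T" by (auto simp: hit_event_def)
    then show ?thesis by simp
  qed simp
  then show ?case by simp
next
  case (Suc m)
  let ?M = "triple_process l n m" and ?B = "hit_event l n r"
  let ?N = "\<lambda>hs. if available l n (last hs) = {} then return_pmf hs
       else map_pmf (\<lambda>e. hs @ [insert e (last hs)]) (pmf_of_set (available l n (last hs)))"
  \<comment> \<open>Pointwise majorant for one step: either the event has happened already, or the
    step supplies the last missing \<open>e\<close> in \<open>T\<close>, each \<open>e\<close>
    having conditional probability at most \<open>r\<close>.\<close>
  let ?f = "\<lambda>hs. indicator (?B T) hs + r * (\<Sum>e\<in>T. indicator (?B (T - {e})) hs) :: real"
  have step: "measure_pmf.prob (?N hs) (?B T) \<le> ?f hs" if hs: "hs \<in> set_pmf ?M" for hs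
  proof -
    have ne: "hs \<noteq> []" using hs by (rule triple_process_nonempty)
    have pos: "0 \<le> r * (\<Sum>e\<in>T. indicator (?B (T - {e})) hs)"
      using assms(2) by (intro mult_nonneg_nonneg sum_nonneg) auto
    show ?thesis
    proof (cases "hs \<in> ?B T")
      case True
      then show ?thesis using pos measure_pmf.prob_le_1[of "?N hs" "?B T"]
        by (simp only: indicator_simps)
    next
      case out: False
      show ?thesis
      proof (cases "available l n (last hs) = {}")
        case True
        then show ?thesis using out pos by simp
      next
        case False
        let ?Q = "available l n (last hs)"
        let ?R = "{e. hs @ [insert e (last hs)] \<in> ?B T}"
        have "measure_pmf.prob (?N hs) (?B T) = real (card (?Q \<inter> ?R)) / real (card ?Q)"
          using False finite_available[of l n "last hs"]
          by (simp add: measure_pmf_of_set vimage_def)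
        also have "\<dots> \<le> r * (\<Sum>e\<in>T. indicator (?B (T - {e})) hs)"
        proof (cases "?R = {}")
          case True
          then show ?thesis using pos by simp
        next
          case R: False
          \<comment> \<open>The lower bound on \<open>card ?Q\<close> is known only if some choice
            of \<open>e\<close> creates the event, which is why empty \<open>?R\<close> is split
            off.\<close>
          have Q: "1 \<le> r * real (card ?Q)" using R hit_event_snocD(3)[OF _ ne out] by blast
          have cQ: "0 < real (card ?Q)" using False finite_available by (simp add: card_gt_0_iff)
          have "?R \<subseteq> {e \<in> T. hs \<in> ?B (T - {e})}"
            using hit_event_snocD(1,2)[OF _ ne out] by blast
          then have "card (?Q \<inter> ?R) \<le> card {e \<in> T. hs \<in> ?B (T - {e})}"
            using Suc.prems by (intro card_mono) auto
          also have "real \<dots> = (\<Sum>e\<in>T. indicator (?B (T - {e})) hs)"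
            using Suc.prems by (simp add: indicator_def sum.If_cases Int_def)
          finally have c: "real (card (?Q \<inter> ?R)) \<le> (\<Sum>e\<in>T. indicator (?B (T - {e})) hs)"
            by simp
          have "real (card (?Q \<inter> ?R)) \<le> real (card (?Q \<inter> ?R)) * (r * real (card ?Q))"
            using mult_left_mono[OF Q, of "real (card (?Q \<inter> ?R))"] by simp
          then have "real (card (?Q \<inter> ?R)) / real (card ?Q) \<le> r * real (card (?Q \<inter> ?R))"
            using cQ by (simp add: field_simps)
          also have "\<dots> \<le> r * (\<Sum>e\<in>T. indicator (?B (T - {e})) hs)"
            by (intro mult_left_mono c assms)
          finally show ?thesis .
        qed
        finally show ?thesis using out by simp
      qed
    qed
  qed
  have int: "integrable ?M (indicator X :: _ \<Rightarrow> real)" for X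
    by (rule measure_pmf.integrable_const_bound[where B = 1]) (auto simp: indicator_def)
  have "measure_pmf.prob (triple_process l n (Suc m)) (?B T)
      = measure_pmf.expectation ?M (\<lambda>hs. measure_pmf.prob (?N hs) (?B T))"
    by (simp add: prob_bind_pmf)
  also have "\<dots> \<le> measure_pmf.expectation ?M ?f"
  proof (rule integral_mono_AE)
    show "integrable ?M (\<lambda>hs. measure_pmf.prob (?N hs) (?B T))"
      by (rule measure_pmf.integrable_const_bound[where B = 1]) auto
    show "integrable ?M ?f"
      by (intro Bochner_Integration.integrable_add integrable_mult_right
          Bochner_Integration.integrable_sum int)
    show "AE hs in ?M. measure_pmf.prob (?N hs) (?B T) \<le> ?f hs"
      unfolding AE_measure_pmf_iff using step by blast
  qed
  also have "\<dots> = measure_pmf.prob ?M (?B T) + r * (\<Sum>e\<in>T. measure_pmf.prob ?M (?B (T - {e})))"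
    by (simp add: int Bochner_Integration.integral_add Bochner_Integration.integral_sum)
  also have "\<dots> \<le> (real m * r) ^ card T + r * (\<Sum>e\<in>T. (real m * r) ^ (card T - 1))"
  proof (intro add_mono mult_left_mono sum_mono assms)
    fix e assume "e \<in> T"
    then show "measure_pmf.prob ?M (?B (T - {e})) \<le> (real m * r) ^ (card T - 1)"
      using Suc.IH[of "T - {e}"] Suc.prems by simp
  qed (use Suc in auto)
  also have "\<dots> \<le> (real (Suc m) * r) ^ card T"
  proof (cases "card T")
    case (Suc k)
    \<comment> \<open>The left side consists of the two leading terms of the binomial expansion of
      the right side.\<close>
    have "real m ^ Suc k + real (Suc k) * real m ^ k \<le> (real m + 1) ^ Suc k"
    proof (induction k)
      case (Suc k)
      have "real m ^ Suc (Suc k) + real (Suc (Suc k)) * real m ^ Suc k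
          \<le> (real m ^ Suc k + real (Suc k) * real m ^ k) * (real m + 1)"
        by (simp add: algebra_simps)
      also have "\<dots> \<le> (real m + 1) ^ Suc k * (real m + 1)"
        using Suc.IH by (intro mult_right_mono) auto
      finally show ?case by (simp add: mult_ac)
    qed simp
    then have "(real m ^ Suc k + real (Suc k) * real m ^ k) * r ^ Suc k
        \<le> (real m + 1) ^ Suc k * r ^ Suc k"
      using assms(2) by (intro mult_right_mono) auto
    also have "\<dots> = (real (Suc m) * r) ^ card T"
      unfolding Suc power_mult_distrib by (simp add: add.commute)
    finally show ?thesis
      using Suc by (simp add: power_mult_distrib algebra_simps)
  qed simp
  finally show ?case .
qed

text \<open>Removing the head \<open>a\<close> of a list splits the union into the union
  \<open>U\<close> of the tail and \<open>D a - U\<close>, so summing over \<open>a\<close> costs a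
  factor \<open>K\<close> uniformly in the tail. The length \<open>k\<close> varies in the induction
  while \<open>s\<close> stays fixed, so that one size bound \<open>d * s\<close> on
  \<open>U\<close> serves every stage.\<close>

lemma sum_power_card_Union_lists_le:
  fixes D :: "'a \<Rightarrow> 'b set" and x K :: real
  assumes "finite X" "0 \<le> x" "0 \<le> K"
    and D: "\<And>a. a \<in> X \<Longrightarrow> finite (D a) \<and> card (D a) \<le> d"
    and step: "\<And>U. U \<subseteq> \<Union>(D ` X) \<Longrightarrow> card U \<le> d * s \<Longrightarrow> (\<Sum>a\<in>X. x ^ card (D a - U)) \<le> K"
    and "k \<le> s"
  shows "(\<Sum>xs | set xs \<subseteq> X \<and> length xs = k. x ^ card (\<Union>(D ` set xs))) \<le> K ^ k"
  using \<open>k \<le> s\<close>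
proof (induction k)
  case 0
  have "{xs. set xs \<subseteq> X \<and> length xs = 0} = {[]}" by auto
  then show ?case by simp
next
  case (Suc k)
  let ?L = "{xs. set xs \<subseteq> X \<and> length xs = k}"
  let ?U = "\<lambda>xs. \<Union>(D ` set xs)"
  have inj: "inj_on (\<lambda>(xs, a). a # xs) (?L \<times> X)" by (auto simp: inj_on_def)
  have "(\<Sum>xs | set xs \<subseteq> X \<and> length xs = Suc k. x ^ card (?U xs))
      = (\<Sum>xs\<in>?L. \<Sum>a\<in>X. x ^ card (D a \<union> ?U xs))"
    unfolding lists_length_Suc_eq sum.reindex[OF inj]
    by (simp add: sum.cartesian_product case_prod_unfold)
  also have "\<dots> \<le> (\<Sum>xs\<in>?L. x ^ card (?U xs) * K)"
  proof (rule sum_mono)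
    fix xs assume xs: "xs \<in> ?L"
    have fin: "finite (?U xs)" using xs D by auto
    have "card (?U xs) \<le> (\<Sum>a\<in>set xs. card (D a))" by (rule card_UN_le) simp
    also have "\<dots> \<le> (\<Sum>a\<in>set xs. d)" using xs D by (intro sum_mono) auto
    also have "\<dots> \<le> d * s"
      using Suc.prems xs card_length[of xs] by (simp add: mult.commute)
    finally have "card (?U xs) \<le> d * s" .
    then have le: "(\<Sum>a\<in>X. x ^ card (D a - ?U xs)) \<le> K" using xs by (intro step) auto
    have "card (D a \<union> ?U xs) = card (?U xs) + card (D a - ?U xs)" if "a \<in> X" for a
      using card_Un_disjoint[of "?U xs" "D a - ?U xs"] fin D[OF that] by (simp add: Un_commute)
    then have "(\<Sum>a\<in>X. x ^ card (D a \<union> ?U xs)) = x ^ card (?U xs) * (\<Sum>a\<in>X. x ^ card (D a - ?U xs))"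
      by (simp add: power_add sum_distrib_left)
    also have "\<dots> \<le> x ^ card (?U xs) * K"
      using le assms(2) by (intro mult_left_mono) auto
    finally show "(\<Sum>a\<in>X. x ^ card (D a \<union> ?U xs)) \<le> x ^ card (?U xs) * K" .
  qed
  also have "\<dots> = (\<Sum>xs\<in>?L. x ^ card (?U xs)) * K" by (simp add: sum_distrib_right)
  also have "\<dots> \<le> K ^ k * K" using Suc assms(3) by (intro mult_right_mono) auto
  finally show ?case by (simp add: mult.commute)
qed

text \<open>Markov's inequality for an \<open>s\<close>-th moment: on \<open>E\<close> there are
  \<open>card Y ^ s \<ge> a ^ s\<close> lists over \<open>Y\<close> whose events all occur, so
  \<open>a ^ s\<close> times the indicator of \<open>E\<close> is at most the number of occurring
  \<open>B xs\<close>. Taking expectations gives the claim; \<open>Y\<close> may depend on the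
  outcome.\<close>

lemma prob_le_sum_lists:
  fixes M :: "'c pmf" and a :: real
  assumes "finite X" "0 \<le> a"
    and many: "\<And>\<omega>. \<omega> \<in> E \<Longrightarrow>
      \<exists>Y\<subseteq>X. a \<le> real (card Y) \<and> (\<forall>xs. set xs \<subseteq> Y \<and> length xs = s \<longrightarrow> \<omega> \<in> B xs)"
  shows "a ^ s * measure_pmf.prob M E
      \<le> (\<Sum>xs | set xs \<subseteq> X \<and> length xs = s. measure_pmf.prob M (B xs))"
proof -
  let ?L = "\<lambda>Y. {xs. set xs \<subseteq> Y \<and> length xs = s}"
  have int: "integrable M (indicator Z :: _ \<Rightarrow> real)" for Z
    by (rule measure_pmf.integrable_const_bound[where B = 1]) (auto simp: indicator_def)
  have fin: "finite (?L X)" using assms(1) by (rule finite_lists_length_eq)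
  have le: "a ^ s * indicator E \<omega> \<le> (\<Sum>xs\<in>?L X. indicator (B xs) \<omega>)" for \<omega>
  proof (cases "\<omega> \<in> E")
    case True
    then obtain Y where Y: "Y \<subseteq> X" "a \<le> real (card Y)"
      "\<And>xs. set xs \<subseteq> Y \<Longrightarrow> length xs = s \<Longrightarrow> \<omega> \<in> B xs" using many by meson
    have "a ^ s \<le> real (card Y) ^ s" using Y(2) assms(2) by (rule power_mono)
    also have "\<dots> = real (card (?L Y))"
      using finite_subset[OF Y(1) assms(1)] by (simp add: card_lists_length_eq)
    also have "\<dots> = (\<Sum>xs\<in>?L Y. indicator (B xs) \<omega>)" using Y(3) by simp
    also have "\<dots> \<le> (\<Sum>xs\<in>?L X. indicator (B xs) \<omega>)"
      using Y(1) by (intro sum_mono2 fin) auto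
    finally show ?thesis using True by simp
  qed (auto intro: sum_nonneg)
  have "a ^ s * measure_pmf.prob M E = measure_pmf.expectation M (\<lambda>\<omega>. a ^ s * indicator E \<omega>)"
    by simp
  also have "\<dots> \<le> measure_pmf.expectation M (\<lambda>\<omega>. \<Sum>xs\<in>?L X. indicator (B xs) \<omega>)"
    by (intro integral_mono integrable_mult_right Bochner_Integration.integrable_sum int le)
  also have "\<dots> = (\<Sum>xs\<in>?L X. measure_pmf.prob M (B xs))"
    by (simp add: int Bochner_Integration.integral_sum)
  finally show ?thesis .
qed

section \<open>Counting extensions by their overlap with a set of triples\<close>

definition extension_maps ::
  "nat \<Rightarrow> ('a \<Rightarrow> nat) \<Rightarrow> 'a hypergraph \<Rightarrow> 'a hypergraph \<Rightarrow> ('a \<Rightarrow> nat) set" where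
  "extension_maps n \<rho> G H = {\<psi> \<in> injections (verts H) {1..n}. \<forall>x\<in>verts G. \<psi> x = \<rho> x}"

definition new_triples :: "'a hypergraph \<Rightarrow> 'a hypergraph \<Rightarrow> ('a \<Rightarrow> nat) \<Rightarrow> nat set set" where
  "new_triples G H \<psi> = (\<lambda>e. \<psi> ` e) ` (triples H - triples G)"

text \<open>The range of the maximum in the theorem, and at the same time the set of possible
  overlaps of an extension with earlier ones. This double role is what lets the moment bound match
  the maximum.\<close>

definition intermediate :: "'a hypergraph \<Rightarrow> 'a hypergraph \<Rightarrow> 'a hypergraph set" where
  "intermediate G H = {J. subhypergraph G J \<and> subhypergraph J H}"

definition extension_scale :: "nat \<Rightarrow> 'a hypergraph \<Rightarrow> 'a hypergraph \<Rightarrow> real" where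
  "extension_scale n G H =
     Max {real n powi ((int (v_num H) - int (e_num H)) + (int (e_num J) - int (v_num J)))
          | J. subhypergraph G J \<and> subhypergraph J H}"

lemma extension_scale_eq:
  "extension_scale n G H =
     Max ((\<lambda>J. real n powi ((int (v_num H) - int (e_num H)) + (int (e_num J) - int (v_num J))))
       ` intermediate G H)"
  unfolding extension_scale_def intermediate_def by (rule arg_cong[of _ _ Max]) blast

lemma extension_count_eq:
  "extension_count n S \<rho> G H = card {\<psi> \<in> extension_maps n \<rho> G H. new_triples G H \<psi> \<subseteq> S}"
  unfolding extension_count_def extension_maps_def new_triples_def
  by (rule arg_cong[of _ _ card]) auto

lemma extension_bounded_iff:
  "extension_bounded l \<alpha> n S \<longleftrightarrow>
     (\<forall>(G, H)\<in>extension_pairs l. \<forall>\<rho>\<in>injections (verts G) {1..n}.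
        real (extension_count n S \<rho> G H) \<le> real n powr (\<alpha> / 9) * extension_scale n G H)"
  unfolding extension_bounded_def extension_scale_def ..

lemma uniform3_finite:
  assumes "uniform3 F"
  shows "finite (verts F)" "finite (triples F)"
  using assms finite_subset[of "triples F" "Pow (verts F)"]
  unfolding uniform3_def triples_on_def by auto

lemma finite_injections:
  assumes "finite X" "finite Y"
  shows "finite (injections X Y)" "card (injections X Y) \<le> card Y ^ card X"
proof -
  have "injections X Y \<subseteq> X \<rightarrow>\<^sub>E Y" by (auto simp: injections_def)
  moreover have "finite (X \<rightarrow>\<^sub>E Y)" using assms by (intro finite_PiE) auto
  ultimately show "finite (injections X Y)" "card (injections X Y) \<le> card Y ^ card X"
    using card_mono[of "X \<rightarrow>\<^sub>E Y"] assms(1) by (auto simp: finite_subset card_funcsetE)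
qed

lemma finite_extension_maps:
  assumes "uniform3 H"
  shows "finite (extension_maps n \<rho> G H)"
  using finite_injections(1)[OF uniform3_finite(1)[OF assms], of "{1..n}"]
  by (auto simp: extension_maps_def)

lemma intermediate_finite:
  assumes "uniform3 H"
  shows "finite (intermediate G H)" "card (intermediate G H) \<le> 2 ^ (v_num H + e_num H)"
proof -
  let ?P = "Pow (verts H) \<times> Pow (triples H)"
  note fin = uniform3_finite[OF assms]
  have sub: "intermediate G H \<subseteq> ?P"
    by (auto simp: intermediate_def subhypergraph_def mem_Times_iff)
  then show "finite (intermediate G H)" using fin by (auto intro: finite_subset)
  have "card (intermediate G H) \<le> card ?P" using sub fin by (intro card_mono) auto
  then show "card (intermediate G H) \<le> 2 ^ (v_num H + e_num H)"
    using fin by (simp add: card_cartesian_product card_Pow power_add)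
qed

lemma inj_on_triple_image:
  assumes "uniform3 H" "\<psi> \<in> injections (verts H) Y"
  shows "inj_on (\<lambda>e. \<psi> ` e) (triples H)"
  using assms unfolding injections_def uniform3_def triples_on_def
  by (intro inj_onI) (auto simp: inj_on_image_eq_iff subset_eq)

text \<open>The extensions \<open>\<psi>\<close> are grouped by the hypergraph \<open>J\<close> of vertices and triples that are
  mapped into \<open>G\<close> or \<open>U\<close>: only the vertices outside \<open>J\<close> are free, and exactly the
  triples outside \<open>J\<close> are new.\<close>

lemma sum_extension_maps_le:
  fixes x :: real
  assumes GH: "subhypergraph G H" and "0 \<le> x"
    and U: "finite U" "\<And>e. e \<in> U \<Longrightarrow> finite e" "card (\<Union>U) \<le> w" "1 \<le> w"
  shows "(\<Sum>\<psi>\<in>extension_maps n \<rho> G H. x ^ card (new_triples G H \<psi> - U))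
    \<le> (\<Sum>J\<in>intermediate G H.
          real w ^ v_num H * (real n ^ (v_num H - v_num J) * x ^ (e_num H - e_num J)))"
proof -
  let ?X = "extension_maps n \<rho> G H"
  have uG: "uniform3 G" and uH: "uniform3 H" and sub: "verts G \<subseteq> verts H" "triples G \<subseteq> triples H"
    using GH by (auto simp: subhypergraph_def)
  note fH = uniform3_finite[OF uH]
  have tri: "e \<subseteq> verts H" "card e = 3" if "e \<in> triples H" for e
    using uH that by (auto simp: uniform3_def triples_on_def)
  define ov where "ov \<psi> = ({y \<in> verts H. y \<in> verts G \<or> \<psi> y \<in> \<Union>U},
      triples G \<union> {e \<in> triples H. \<psi> ` e \<in> U})" for \<psi> :: "'a \<Rightarrow> nat"
  \<comment> \<open>A triple mapped to an element of \<open>U\<close> has all its vertices mapped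
    into \<open>\<Union>U\<close>, so the triples of \<open>ov \<psi>\<close> lie on its
    vertices.\<close>
  have ov: "ov \<psi> \<in> intermediate G H" for \<psi>
    using uG uH sub tri fH(1) unfolding ov_def intermediate_def subhypergraph_def
    by (auto simp: uniform3_def triples_on_def subset_eq)
  have group: "(\<Sum>\<psi> | \<psi> \<in> ?X \<and> ov \<psi> = J. x ^ card (new_triples G H \<psi> - U))
      \<le> real w ^ v_num H * (real n ^ (v_num H - v_num J) * x ^ (e_num H - e_num J))"
    if J: "J \<in> intermediate G H" for J
  proof -
    let ?XJ = "{\<psi> \<in> ?X. ov \<psi> = J}"
    have vJ: "verts J \<subseteq> verts H" "verts G \<subseteq> verts J" "triples J \<subseteq> triples H"
      using J by (auto simp: intermediate_def subhypergraph_def)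
    have eq: "card (new_triples G H \<psi> - U) = e_num H - e_num J" if "\<psi> \<in> ?XJ" for \<psi>
    proof -
      have inj: "inj_on (\<lambda>e. \<psi> ` e) (triples H)"
        using that uH by (intro inj_on_triple_image) (auto simp: extension_maps_def)
      have "triples J = triples G \<union> {e \<in> triples H. \<psi> ` e \<in> U}"
        using that by (auto simp: ov_def)
      then have "new_triples G H \<psi> - U = (\<lambda>e. \<psi> ` e) ` (triples H - triples J)"
        by (auto simp: new_triples_def)
      then have "card (new_triples G H \<psi> - U) = card (triples H - triples J)"
        using card_image[OF inj_on_subset[OF inj, of "triples H - triples J"]] by simp
      then show ?thesis
        using card_Diff_subset[OF finite_subset[OF vJ(3) fH(2)] vJ(3)] by simp
    qed
    let ?R = "\<lambda>y. if y \<in> verts G then {\<rho> y} else if y \<in> verts J then \<Union>U else {1..n}"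
    have "?XJ \<subseteq> (\<Pi>\<^sub>E y\<in>verts H. ?R y)"
      by (auto simp: extension_maps_def injections_def ov_def PiE_iff extensional_def)
    moreover have "finite (\<Pi>\<^sub>E y\<in>verts H. ?R y)"
      using fH(1) U(1,2) by (intro finite_PiE) auto
    ultimately have "card ?XJ \<le> card (\<Pi>\<^sub>E y\<in>verts H. ?R y)" by (rule card_mono[rotated])
    also have "\<dots> = (\<Prod>y\<in>verts H. card (?R y))" using fH(1) by (rule card_PiE)
    \<comment> \<open>A factor \<open>w \<ge> 1\<close> is granted to every vertex, also to those
      with one or \<open>n\<close> choices, so that the product no longer depends on how
      \<open>J\<close> arises.\<close>
    also have "\<dots> \<le> (\<Prod>y\<in>verts H. w * (if y \<in> verts J then 1 else n))"
      using U(3,4) vJ(2) by (intro prod_mono) auto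
    also have "\<dots> = w ^ v_num H * n ^ card (verts H - verts J)"
      using fH(1) by (simp add: prod.distrib prod.If_cases Diff_eq)
    also have "card (verts H - verts J) = v_num H - v_num J"
      using vJ(1) fH(1) by (intro card_Diff_subset) (auto intro: finite_subset)
    finally have "card ?XJ \<le> w ^ v_num H * n ^ (v_num H - v_num J)" .
    then have "real (card ?XJ) \<le> real (w ^ v_num H * n ^ (v_num H - v_num J))"
      by (simp only: of_nat_le_iff)
    then have c: "real (card ?XJ) \<le> real w ^ v_num H * real n ^ (v_num H - v_num J)" by simp
    have "(\<Sum>\<psi>\<in>?XJ. x ^ card (new_triples G H \<psi> - U)) = real (card ?XJ) * x ^ (e_num H - e_num J)"
      using eq by simp
    also have "\<dots> \<le> real w ^ v_num H * real n ^ (v_num H - v_num J) * x ^ (e_num H - e_num J)"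
      using c assms(2) by (intro mult_right_mono) auto
    finally show ?thesis by (simp add: mult.assoc)
  qed
  have "(\<Sum>\<psi>\<in>?X. x ^ card (new_triples G H \<psi> - U))
      = (\<Sum>J\<in>intermediate G H. \<Sum>\<psi> | \<psi> \<in> ?X \<and> ov \<psi> = J. x ^ card (new_triples G H \<psi> - U))"
    using ov by (intro sum.group[symmetric] finite_extension_maps intermediate_finite uH) auto
  also have "\<dots> \<le> (\<Sum>J\<in>intermediate G H.
          real w ^ v_num H * (real n ^ (v_num H - v_num J) * x ^ (e_num H - e_num J)))"
    by (intro sum_mono group)
  finally show ?thesis .
qed

text \<open>The term for \<open>J = H\<close> has exponent 0, so the maximum is over a nonempty set
  and positive. Positivity permits cancelling it in the moment inequality.\<close>

lemma extension_scale_bounds: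
  assumes "subhypergraph G H" "1 \<le> n"
  shows "0 < extension_scale n G H"
    and "J \<in> intermediate G H \<Longrightarrow>
      real n powi ((int (v_num H) - int (e_num H)) + (int (e_num J) - int (v_num J)))
        \<le> extension_scale n G H"
proof -
  let ?f = "\<lambda>J. real n powi ((int (v_num H) - int (e_num H)) + (int (e_num J) - int (v_num J)))"
  have fin: "finite (?f ` intermediate G H)"
    using assms(1) intermediate_finite(1)[of H G] by (simp add: subhypergraph_def)
  show le: "?f J \<le> extension_scale n G H" if "J \<in> intermediate G H" for J
    unfolding extension_scale_eq using fin that by (intro Max_ge) auto
  have "H \<in> intermediate G H"
    using assms(1) by (auto simp: intermediate_def subhypergraph_def)
  moreover have "0 < ?f H" using assms(2) by (intro zero_less_power_int) auto
  ultimately show "0 < extension_scale n G H" using le less_le_trans by blast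
qed

text \<open>The base \<open>C * real n powr (\<gamma> - 1)\<close> is nearly \<open>1 / n\<close>,
  so each missing vertex contributes \<open>n\<close> and each missing triple about
  \<open>1 / n\<close>. Up to \<open>C\<close> and powers of \<open>n powr \<gamma>\<close> the term
  of \<open>J\<close> is then exactly the power of \<open>n\<close> that occurs for \<open>J\<close>
  in \<open>extension_scale\<close>; there are at most \<open>2 ^ (2 * d)\<close> such
  \<open>J\<close>.\<close>

lemma sum_intermediate_le:
  fixes C \<gamma> :: real
  assumes GH: "subhypergraph G H" and d: "v_num H \<le> d" "e_num H \<le> d"
    and n: "1 \<le> n" and "1 \<le> C" "0 \<le> \<gamma>" and w: "1 \<le> w"
  shows "(\<Sum>J\<in>intermediate G H.
          real w ^ v_num H * (real n ^ (v_num H - v_num J) * (C * real n powr (\<gamma> - 1)) ^ (e_num H - e_num J)))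
     \<le> 2 ^ (2 * d) * real w ^ d * C ^ d * real n powr (\<gamma> * d) * extension_scale n G H"
proof -
  have uH: "uniform3 H" using GH by (simp add: subhypergraph_def)
  have bound: "real w ^ v_num H * (real n ^ (v_num H - v_num J) * (C * real n powr (\<gamma> - 1)) ^ (e_num H - e_num J))
      \<le> real w ^ d * C ^ d * real n powr (\<gamma> * d) * extension_scale n G H"
    if J: "J \<in> intermediate G H" for J
  proof -
    have "v_num J \<le> v_num H" "e_num J \<le> e_num H"
      using J uniform3_finite[OF uH] by (auto simp: intermediate_def subhypergraph_def intro: card_mono)
    note ve = this
    let ?a = "v_num H - v_num J" and ?b = "e_num H - e_num J"
    have np: "0 < real n" using n by simp
    have pw: "(real n powr c) ^ k = real n powr (c * real k)" for c k
      using np by (simp add: powr_power mult.commute)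
    have "real n ^ ?a * (C * real n powr (\<gamma> - 1)) ^ ?b
        = C ^ ?b * (real n powr real ?a * real n powr ((\<gamma> - 1) * real ?b))"
      unfolding power_mult_distrib powr_realpow[OF np] pw by (simp only: mult_ac)
    \<comment> \<open>The exponent is regrouped as
      \<open>?a + (\<gamma> - 1) * ?b = \<gamma> * ?b + (?a - ?b)\<close>, and
      \<open>?a - ?b\<close> is the exponent in the scale.\<close>
    also have "real n powr real ?a * real n powr ((\<gamma> - 1) * real ?b)
        = real n powr (\<gamma> * ?b) * real n powr (real ?a - real ?b)"
      by (simp add: powr_add[symmetric] algebra_simps)
    also have "real ?a - real ?b
        = real_of_int ((int (v_num H) - int (e_num H)) + (int (e_num J) - int (v_num J)))"
      using ve by (simp add: of_nat_diff)
    also have "real n powr \<dots>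
        = real n powi ((int (v_num H) - int (e_num H)) + (int (e_num J) - int (v_num J)))"
      using np by (intro powr_real_of_int') auto
    finally have "real n ^ ?a * (C * real n powr (\<gamma> - 1)) ^ ?b
        \<le> C ^ ?b * (real n powr (\<gamma> * ?b) * extension_scale n G H)"
      using extension_scale_bounds(2)[OF GH n J] assms(5) by (auto intro!: mult_left_mono)
    also have "\<dots> \<le> C ^ d * (real n powr (\<gamma> * d) * extension_scale n G H)"
      using d assms(5,6) n extension_scale_bounds(1)[OF GH n]
      by (intro mult_mono power_increasing powr_mono mult_left_mono mult_nonneg_nonneg) auto
    finally have 1: "real n ^ ?a * (C * real n powr (\<gamma> - 1)) ^ ?b
        \<le> C ^ d * (real n powr (\<gamma> * d) * extension_scale n G H)" .
    have "real w ^ v_num H \<le> real w ^ d" using w d by (intro power_increasing) auto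
    then have "real w ^ v_num H * (real n ^ ?a * (C * real n powr (\<gamma> - 1)) ^ ?b)
        \<le> real w ^ d * (C ^ d * (real n powr (\<gamma> * d) * extension_scale n G H))"
      using mult_mono[OF _ 1] assms(5) by simp
    then show ?thesis by (simp add: mult.assoc)
  qed
  have "(2::nat) ^ (v_num H + e_num H) \<le> 2 ^ (2 * d)" using d by (intro power_increasing) auto
  then have "card (intermediate G H) \<le> 2 ^ (2 * d)"
    using intermediate_finite(2)[OF uH, of G] by linarith
  then have c: "real (card (intermediate G H)) \<le> 2 ^ (2 * d)"
    by (metis of_nat_le_iff of_nat_numeral of_nat_power)
  have "(\<Sum>J\<in>intermediate G H.
          real w ^ v_num H * (real n ^ (v_num H - v_num J) * (C * real n powr (\<gamma> - 1)) ^ (e_num H - e_num J)))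
      \<le> real (card (intermediate G H)) * (real w ^ d * C ^ d * real n powr (\<gamma> * d) * extension_scale n G H)"
    by (intro sum_bounded_above bound)
  also have "\<dots> \<le> 2 ^ (2 * d) * (real w ^ d * C ^ d * real n powr (\<gamma> * d) * extension_scale n G H)"
    using assms(5) extension_scale_bounds(1)[OF GH n] by (intro mult_right_mono c) auto
  finally show ?thesis by (simp add: mult.assoc)
qed

text \<open>When the count exceeds the threshold at step \<open>i\<close>, every list of
  \<open>s\<close> of the extensions present at that step has all its new triples in the hypergraph.
  The moment inequality with hitting probabilities then applies; the scale cancels between threshold
  and moment, leaving a gain of \<open>n powr (\<delta> - \<gamma> * d)\<close> per
  extension.\<close>

lemma prob_large_extension_count:
  fixes C \<gamma> \<delta> r :: real
  assumes GH: "subhypergraph G H" and d: "v_num H \<le> d" "e_num H \<le> d"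
    and n: "1 \<le> n" and C: "1 \<le> C" and \<gamma>: "0 \<le> \<gamma>"
    and r: "0 \<le> r" "real m * r \<le> C * real n powr (\<gamma> - 1)"
  shows "measure_pmf.prob (triple_process l n m)
      {hs. \<exists>i<length hs. (\<forall>j<i. 1 \<le> r * real (card (available l n (hs ! j)))) \<and>
         real n powr \<delta> * extension_scale n G H < real (extension_count n (hs ! i) \<rho> G H)}
    \<le> (2 ^ (2 * d) * real (3 * d * s + 1) ^ d * C ^ d * real n powr (\<gamma> * d - \<delta>)) ^ s"
    (is "measure_pmf.prob ?M ?E \<le> ?b ^ s")
proof -
  let ?X = "extension_maps n \<rho> G H" and ?D = "new_triples G H"
  let ?x = "C * real n powr (\<gamma> - 1)"
  let ?a = "real n powr \<delta> * extension_scale n G H"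
  let ?K = "2 ^ (2 * d) * real (3 * d * s + 1) ^ d * C ^ d * real n powr (\<gamma> * d) * extension_scale n G H"
  let ?B = "\<lambda>xs. hit_event l n r (\<Union>(?D ` set xs))"
  have uH: "uniform3 H" using GH by (simp add: subhypergraph_def)
  note fH = uniform3_finite[OF uH]
  have scale: "0 < extension_scale n G H" using GH n by (rule extension_scale_bounds(1))
  have a: "0 < ?a" using scale n by simp
  have finX: "finite ?X" using uH by (rule finite_extension_maps)
  have D: "finite (?D \<psi>) \<and> card (?D \<psi>) \<le> d" for \<psi>
  proof -
    have "card (?D \<psi>) \<le> card (triples H - triples G)"
      unfolding new_triples_def using fH(2) by (intro card_image_le) auto
    also have "\<dots> \<le> e_num H" using fH(2) by (intro card_mono) auto
    finally show ?thesis using d(2) fH(2) by (simp add: new_triples_def)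
  qed
  have D3: "card e = 3" if \<psi>: "\<psi> \<in> ?X" "e \<in> ?D \<psi>" for \<psi> e
  proof -
    obtain e' where e': "e' \<in> triples H" "e = \<psi> ` e'" using \<psi>(2) by (auto simp: new_triples_def)
    then have "e' \<subseteq> verts H" "card e' = 3" using uH by (auto simp: uniform3_def triples_on_def)
    moreover have "inj_on \<psi> (verts H)" using \<psi>(1) by (auto simp: extension_maps_def injections_def)
    ultimately show ?thesis using e'(2) card_image inj_on_subset by metis
  qed
  have step: "(\<Sum>\<psi>\<in>?X. ?x ^ card (?D \<psi> - U)) \<le> ?K"
    if U: "U \<subseteq> \<Union>(?D ` ?X)" "card U \<le> d * s" for U
  proof -
    have finU: "finite U" using U(1) D finX by (auto intro: finite_subset)
    have U3: "card e = 3" if "e \<in> U" for e using D3 U(1) that by blast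
    have "card (\<Union>U) \<le> (\<Sum>e\<in>U. card e)" using card_Union_le_sum_card by blast
    also have "\<dots> = 3 * card U" using U3 by simp
    \<comment> \<open>The summand 1 keeps the bound on \<open>card (\<Union>U)\<close> positive even
      if \<open>d * s = 0\<close>.\<close>
    also have "\<dots> \<le> 3 * d * s + 1" using U(2) by simp
    finally have "card (\<Union>U) \<le> 3 * d * s + 1" .
    moreover have "finite e" if "e \<in> U" for e using U3[OF that] by (intro card_ge_0_finite) simp
    ultimately have "(\<Sum>\<psi>\<in>?X. ?x ^ card (?D \<psi> - U)) \<le> (\<Sum>J\<in>intermediate G H.
        real (3 * d * s + 1) ^ v_num H * (real n ^ (v_num H - v_num J) * ?x ^ (e_num H - e_num J)))"
      using C finU by (intro sum_extension_maps_le GH) auto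
    also have "\<dots> \<le> ?K" using assms by (intro sum_intermediate_le) auto
    finally show ?thesis .
  qed
  have "?a ^ s * measure_pmf.prob ?M ?E
      \<le> (\<Sum>xs | set xs \<subseteq> ?X \<and> length xs = s. measure_pmf.prob ?M (?B xs))"
  proof (rule prob_le_sum_lists[OF finX])
    show "0 \<le> ?a" using a by simp
    fix hs assume "hs \<in> ?E"
    then obtain i where i: "i < length hs"
      "\<And>j. j < i \<Longrightarrow> 1 \<le> r * real (card (available l n (hs ! j)))"
      "?a < real (extension_count n (hs ! i) \<rho> G H)" by blast
    let ?Y = "{\<psi> \<in> ?X. ?D \<psi> \<subseteq> hs ! i}"
    \<comment> \<open>One index \<open>i\<close> witnesses the hitting events of all lists over
      \<open>?Y\<close> at once.\<close>
    have "hs \<in> ?B xs" if "set xs \<subseteq> ?Y" for xs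
      unfolding hit_event_def using that i(1,2) by (auto intro!: exI[of _ i])
    then show "\<exists>Y\<subseteq>?X. ?a \<le> real (card Y) \<and> (\<forall>xs. set xs \<subseteq> Y \<and> length xs = s \<longrightarrow> hs \<in> ?B xs)"
      using i(3) by (intro exI[of _ ?Y]) (auto simp: extension_count_eq)
  qed
  also have "\<dots> \<le> (\<Sum>xs | set xs \<subseteq> ?X \<and> length xs = s. ?x ^ card (\<Union>(?D ` set xs)))"
  proof (rule sum_mono)
    fix xs
    have "measure_pmf.prob ?M (?B xs) \<le> (real m * r) ^ card (\<Union>(?D ` set xs))"
      using D r(1) by (intro prob_hit_event) auto
    also have "\<dots> \<le> ?x ^ card (\<Union>(?D ` set xs))" using r by (intro power_mono) auto
    finally show "measure_pmf.prob ?M (?B xs) \<le> ?x ^ card (\<Union>(?D ` set xs))" .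
  qed
  also have "\<dots> \<le> ?K ^ s"
  proof (rule sum_power_card_Union_lists_le[where d = d and s = s])
    show "0 \<le> ?K" using C scale by simp
  qed (use C D finX step in auto)
  also have "?K = ?a * ?b"
    by (simp add: powr_diff)
  finally have "?a ^ s * measure_pmf.prob ?M ?E \<le> ?a ^ s * ?b ^ s"
    by (simp only: power_mult_distrib)
  then show ?thesis using a by (simp only: mult_le_cancel_left_pos zero_less_power)
qed

section \<open>Relabelling to finitely many pairs of hypergraphs\<close>

definition relabel :: "('a \<Rightarrow> 'b) \<Rightarrow> 'a hypergraph \<Rightarrow> 'b hypergraph" where
  "relabel f F = (f ` verts F, (\<lambda>e. f ` e) ` triples F)"

lemma relabel_subhypergraph:
  assumes "subhypergraph J F" "inj_on f (verts F)"
  shows "subhypergraph (relabel f J) (relabel f F)"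
    "v_num (relabel f J) = v_num J" "e_num (relabel f J) = e_num J"
proof -
  have u: "uniform3 J" "uniform3 F" and sub: "verts J \<subseteq> verts F" "triples J \<subseteq> triples F"
    using assms(1) by (auto simp: subhypergraph_def)
  have inj: "inj_on f (verts J)" using assms(2) sub(1) by (rule inj_on_subset)
  show "subhypergraph (relabel f J) (relabel f F)"
    using image_hypergraph(1)[OF u(1) inj] image_hypergraph(1)[OF u(2) assms(2)] sub
    by (auto simp: subhypergraph_def relabel_def)
  show "v_num (relabel f J) = v_num J" "e_num (relabel f J) = e_num J"
    using image_hypergraph(2,3)[OF u(1) inj] by (simp_all add: relabel_def)
qed

lemma relabel_inverse:
  assumes "uniform3 F" "\<And>x. x \<in> verts F \<Longrightarrow> g (f x) = x"
  shows "relabel g (relabel f F) = F"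
proof -
  have "g ` f ` e = e" if "e \<subseteq> verts F" for e
    using that assms(2) by (force simp: image_image)
  moreover have "e \<subseteq> verts F" if "e \<in> triples F" for e
    using that assms(1) by (auto simp: uniform3_def triples_on_def)
  ultimately show ?thesis by (simp add: relabel_def image_image prod_eq_iff)
qed

text \<open>Pulling an intermediate hypergraph back along the inverse of \<open>f\<close> keeps its
  numbers of vertices and triples, so every value in the relabelled maximum already occurs in the
  original one.\<close>

lemma extension_scale_relabel_le:
  assumes GH: "subhypergraph G H" and inj: "inj_on f (verts H)"
  shows "extension_scale n (relabel f G) (relabel f H) \<le> extension_scale n G H"
proof -
  let ?g = "inv_into (verts H) f"
  let ?e = "\<lambda>H J. real n powi ((int (v_num H) - int (e_num H)) + (int (e_num J) - int (v_num J)))"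
  have uG: "uniform3 G" and uH: "uniform3 H" and sub: "verts G \<subseteq> verts H"
    using GH by (auto simp: subhypergraph_def)
  have HH: "subhypergraph H H" using uH by (simp add: subhypergraph_def)
  have undo: "relabel ?g (relabel f F) = F" if "uniform3 F" "verts F \<subseteq> verts H" for F
    using that inj by (intro relabel_inverse) auto
  have mem: "?e (relabel f H) J \<in> ?e H ` intermediate G H"
    if J: "J \<in> intermediate (relabel f G) (relabel f H)" for J
  proof -
    have ginj: "inj_on ?g (verts (relabel f H))" by (simp add: relabel_def inj_on_inv_into)
    have GJ: "subhypergraph (relabel f G) J" and JH: "subhypergraph J (relabel f H)"
      using J by (auto simp: intermediate_def)
    have Jinj: "inj_on ?g (verts J)"
      using ginj JH by (auto simp: subhypergraph_def intro: inj_on_subset)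
    have "relabel ?g J \<in> intermediate G H"
      using relabel_subhypergraph(1)[OF GJ Jinj] relabel_subhypergraph(1)[OF JH ginj]
        undo[OF uG sub] undo[OF uH subset_refl]
      by (simp add: intermediate_def)
    moreover have "?e (relabel f H) J = ?e H (relabel ?g J)"
      using relabel_subhypergraph(2,3)[OF JH ginj] relabel_subhypergraph(2,3)[OF HH inj] by simp
    ultimately show ?thesis by (intro image_eqI)
  qed
  \<comment> \<open>Comparing the two maxima requires the smaller set to be nonempty.\<close>
  have "relabel f H \<in> intermediate (relabel f G) (relabel f H)"
    using relabel_subhypergraph(1)[OF GH inj] relabel_subhypergraph(1)[OF HH inj]
    by (simp add: intermediate_def)
  then show ?thesis
    unfolding extension_scale_eq using mem intermediate_finite(1)[OF uH]
    by (intro Max_mono) auto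
qed

text \<open>Composition with the inverse of \<open>f\<close> sends extensions injectively to
  extensions of the relabelled pair, with the same image triples. The composite is restricted to the
  relabelled vertices because \<open>injections\<close> consists of extensional functions.\<close>

lemma extension_count_relabel_le:
  assumes GH: "subhypergraph G H" and inj: "inj_on f (verts H)"
    and \<rho>: "\<rho> \<in> injections (verts G) {1..n}"
  obtains \<rho>' where "\<rho>' \<in> injections (verts (relabel f G)) {1..n}"
    "extension_count n S \<rho> G H \<le> extension_count n S \<rho>' (relabel f G) (relabel f H)"
proof -
  let ?g = "inv_into (verts H) f"
  let ?r = "\<lambda>F \<psi>. restrict (\<psi> \<circ> ?g) (f ` verts F)"
  let ?X = "{\<psi> \<in> extension_maps n \<rho> G H. new_triples G H \<psi> \<subseteq> S}"
  let ?X' = "{\<psi> \<in> extension_maps n (?r G \<rho>) (relabel f G) (relabel f H).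
      new_triples (relabel f G) (relabel f H) \<psi> \<subseteq> S}"
  have uH: "uniform3 H" and uH': "uniform3 (relabel f H)"
    and sub: "verts G \<subseteq> verts H" "triples G \<subseteq> triples H"
    using GH image_hypergraph(1)[OF _ inj] by (auto simp: subhypergraph_def relabel_def)
  have g: "?g (f x) = x" if "x \<in> verts H" for x using that inj by simp
  have r: "?r F \<psi> \<in> injections (f ` verts F) {1..n}"
    if "\<psi> \<in> injections (verts F) {1..n}" "verts F \<subseteq> verts H" for F \<psi>
    using that g unfolding injections_def inj_on_def
    by (auto simp: PiE_iff subset_eq)
  have eval: "?r F \<psi> (f x) = \<psi> x" if "x \<in> verts F" "verts F \<subseteq> verts H" for F \<psi> x
    using that g by auto
  have tri: "?r H \<psi> ` f ` e = \<psi> ` e" if "e \<in> triples H" for e \<psi>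
  proof -
    have "e \<subseteq> verts H" using uH that by (auto simp: uniform3_def triples_on_def)
    then show ?thesis unfolding image_image using eval[of _ H] by (intro image_cong refl) blast
  qed
  have "inj_on (?r H) ?X"
  proof (rule inj_onI, rule ext)
    fix \<psi> \<phi> x assume h: "\<psi> \<in> ?X" "\<phi> \<in> ?X" "?r H \<psi> = ?r H \<phi>"
    show "\<psi> x = \<phi> x"
    proof (cases "x \<in> verts H")
      case True
      then show ?thesis using fun_cong[OF h(3), of "f x"] g by simp
    next
      case False
      \<comment> \<open>Both maps are extensional, hence \<open>undefined\<close> outside
        \<open>verts H\<close>.\<close>
      then show ?thesis using h(1,2) by (auto simp: extension_maps_def injections_def PiE_def extensional_def)
    qed
  qed
  moreover have "?r H ` ?X \<subseteq> ?X'"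
  proof safe
    fix \<psi> assume \<psi>: "\<psi> \<in> extension_maps n \<rho> G H" "new_triples G H \<psi> \<subseteq> S"
    show "?r H \<psi> \<in> extension_maps n (?r G \<rho>) (relabel f G) (relabel f H)"
      using \<psi>(1) r[of \<psi> H] eval[of _ H \<psi>] eval[of _ G \<rho>] sub
      by (auto simp: extension_maps_def relabel_def subset_eq simp del: restrict_apply)
  next
    fix \<psi> t assume \<psi>: "\<psi> \<in> extension_maps n \<rho> G H" "new_triples G H \<psi> \<subseteq> S"
      and t: "t \<in> new_triples (relabel f G) (relabel f H) (?r H \<psi>)"
    obtain e where e: "e \<in> triples H" "e \<notin> triples G" "t = ?r H \<psi> ` f ` e"
      using t by (auto simp: new_triples_def relabel_def)
    then have "t = \<psi> ` e" by (simp only: tri)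
    then have "t \<in> new_triples G H \<psi>" using e(1,2) by (auto simp: new_triples_def)
    then show "t \<in> S" using \<psi>(2) by blast
  qed
  ultimately have "card ?X \<le> card ?X'"
    using finite_extension_maps[OF uH'] by (intro card_inj_on_le) auto
  then show ?thesis
    using r[OF \<rho> sub(1)] that[of "?r G \<rho>"] by (simp add: extension_count_eq relabel_def)
qed

text \<open>The vertices in \<open>extension_pairs l\<close> are arbitrary naturals, so that set is
  infinite for \<open>l > 0\<close>. The union bound needs a finite set which still meets every
  isomorphism type.\<close>

definition small_extension_pairs :: "nat \<Rightarrow> (nat hypergraph \<times> nat hypergraph) set" where
  "small_extension_pairs l = {(G, H) \<in> extension_pairs l. verts H \<subseteq> {..<2 * l}}"

lemma finite_small_extension_pairs: "finite (small_extension_pairs l)"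
proof -
  let ?S = "Pow {..<2 * l} \<times> Pow (Pow {..<2 * l})"
  have "small_extension_pairs l \<subseteq> ?S \<times> ?S"
    unfolding small_extension_pairs_def extension_pairs_def subhypergraph_def uniform3_def triples_on_def
    by (auto simp: subset_eq)
  then show ?thesis by (rule finite_subset) simp
qed

text \<open>Numbering the vertices of \<open>H\<close> from 0 does not lower the count, for a
  suitable root, and does not raise the scale, so any violation yields one by a small pair.\<close>

lemma not_extension_boundedE:
  assumes "\<not> extension_bounded l \<alpha> n S"
  obtains G H \<rho> where "(G, H) \<in> small_extension_pairs l" "\<rho> \<in> injections (verts G) {1..n}"
    "real n powr (\<alpha> / 9) * extension_scale n G H < real (extension_count n S \<rho> G H)"
proof -
  obtain x where x: "x \<in> extension_pairs l" "\<not> (\<forall>\<rho>\<in>injections (verts (fst x)) {1..n}.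
      real (extension_count n S \<rho> (fst x) (snd x))
        \<le> real n powr (\<alpha> / 9) * extension_scale n (fst x) (snd x))"
    using assms unfolding extension_bounded_iff case_prod_unfold by blast
  then obtain G H \<rho> where GH: "(G, H) \<in> extension_pairs l" and \<rho>: "\<rho> \<in> injections (verts G) {1..n}"
    and large: "real n powr (\<alpha> / 9) * extension_scale n G H < real (extension_count n S \<rho> G H)"
    by (metis not_le prod.collapse)
  have sub: "subhypergraph G H" and sz: "max (v_num H) (e_num H) \<le> 2 * l"
    using GH by (auto simp: extension_pairs_def)
  have uH: "uniform3 H" using sub by (simp add: subhypergraph_def)
  then have HH: "subhypergraph H H" by (simp add: subhypergraph_def)
  obtain f where f: "bij_betw f (verts H) {0..<v_num H}"
    using uniform3_finite(1)[OF uH] ex_bij_betw_finite_nat by blast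
  then have inj: "inj_on f (verts H)" by (simp add: bij_betw_def)
  obtain \<rho>' where \<rho>': "\<rho>' \<in> injections (verts (relabel f G)) {1..n}"
    "extension_count n S \<rho> G H \<le> extension_count n S \<rho>' (relabel f G) (relabel f H)"
    using extension_count_relabel_le[OF sub inj \<rho>] by blast
  have "verts (relabel f H) \<subseteq> {..<2 * l}"
    using f sz by (auto simp: relabel_def bij_betw_def)
  then have "(relabel f G, relabel f H) \<in> small_extension_pairs l"
    using relabel_subhypergraph(1)[OF sub inj] relabel_subhypergraph(2,3)[OF HH inj] sz
    by (simp add: small_extension_pairs_def extension_pairs_def)
  moreover have "real n powr (\<alpha> / 9) * extension_scale n (relabel f G) (relabel f H)
      \<le> real n powr (\<alpha> / 9) * extension_scale n G H"
    by (intro mult_left_mono extension_scale_relabel_le sub inj) auto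
  ultimately show ?thesis using that \<rho>' large by (meson le_less_trans less_le_trans of_nat_mono)
qed

section \<open>The number of available triples along good trajectories\<close>

definition q_min :: "nat \<Rightarrow> real" where
  "q_min l = exp (- (\<Sum>F\<in>family l. 6 * real (e_num F) / real (card (Aut F))))"

lemma q_min_bounds: "0 < q_min l" "q_min l \<le> 1"
  unfolding q_min_def by (auto intro: sum_nonneg)

text \<open>Powers of \<open>6 * t\<close> are at most 1 on this range, so replacing them by 1 in
  the exponent gives a positive lower bound that is free of \<open>n\<close> and
  \<open>t\<close>.\<close>

lemma q_min_le_q_fun:
  assumes "0 \<le> t" "6 * t \<le> 1"
  shows "q_min l \<le> q_fun l t"
proof -
  have "(\<Sum>F\<in>family l. 6 * real (e_num F) / real (card (Aut F)) * (6 * t) ^ (e_num F - 1))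
      \<le> (\<Sum>F\<in>family l. 6 * real (e_num F) / real (card (Aut F)))"
    using assms by (intro sum_mono mult_right_le_one_le power_le_one zero_le_power) auto
  then show ?thesis by (simp add: q_min_def q_fun_def)
qed

text \<open>Before step \<open>m0\<close> one has \<open>p \<ge> n powr (- \<beta>)\<close>, so
  \<open>q_hat / 2\<close> is at least \<open>q_min l * n powr (3 - 3 * \<beta>) / 12\<close>; the
  claim is this bound divided out.\<close>

lemma good_event_card_available:
  assumes "hs \<in> good_event l A \<alpha> n i" "j < i" "1 \<le> n"
    and i: "i \<le> nat \<lceil>(1 - real n powr (- \<beta>)) * real n ^ 2 / 6\<rceil>"
  shows "1 \<le> 12 / q_min l * real n powr (3 * \<beta> - 3) * real (card (available l n (hs ! j)))"
proof -
  let ?t = "real j / real n ^ 2"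
  have n: "0 < real n" using assms(3) by simp
  \<comment> \<open>Strictness matters: an integer below the ceiling is below the unrounded value,
    whereas \<open>i\<close> itself may exceed it.\<close>
  have "int j < \<lceil>(1 - real n powr (- \<beta>)) * real n ^ 2 / 6\<rceil>" using assms(2) i by linarith
  then have "real j < (1 - real n powr (- \<beta>)) * real n ^ 2 / 6" by (simp add: less_ceiling_iff)
  then have p: "real n powr (- \<beta>) \<le> p_fun ?t"
    using n by (simp add: p_fun_def field_simps)
  have t: "0 \<le> ?t" by simp
  have p0: "0 \<le> p_fun ?t" using p by (rule order_trans[rotated]) simp
  then have "6 * ?t \<le> 1" unfolding p_fun_def by linarith
  then have q: "q_min l \<le> q_fun l ?t" using t by (intro q_min_le_q_fun)
  have "(real n powr (- \<beta>)) ^ 3 * q_min l * real n ^ 3 / 6 / 2 \<le> q_hat l n ?t / 2"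
    unfolding q_hat_def using p p0 q q_min_bounds(1)[of l]
    by (intro divide_right_mono mult_right_mono mult_mono power_mono) auto
  also have "\<dots> \<le> real (card (available l n (hs ! j)))"
    using assms(1,2) by (auto simp: good_event_def good_at_def Let_def)
  finally have Q: "(real n powr (- \<beta>)) ^ 3 * q_min l * real n ^ 3 / 6 / 2
      \<le> real (card (available l n (hs ! j)))" .
  have "(real n powr (- \<beta>)) ^ 3 * real n ^ 3 = real n powr (3 - 3 * \<beta>)"
    using n by (simp add: powr_power powr_diff powr_minus field_simps)
  moreover have "real n powr (3 * \<beta> - 3) * real n powr (3 - 3 * \<beta>) = 1"
    using n by (simp add: powr_add[symmetric])
  ultimately have "1 = 12 / q_min l * real n powr (3 * \<beta> - 3)
      * ((real n powr (- \<beta>)) ^ 3 * q_min l * real n ^ 3 / 6 / 2)"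
    using q_min_bounds(1)[of l] by (simp add: field_simps)
  also have "\<dots> \<le> 12 / q_min l * real n powr (3 * \<beta> - 3) * real (card (available l n (hs ! j)))"
    using Q q_min_bounds(1)[of l] by (intro mult_left_mono) auto
  finally show ?thesis .
qed

section \<open>Union bound and choice of the moment\<close>

theorem theorem3p6:
  fixes l :: nat and \<tau> A \<alpha> \<beta> :: real and m0 :: "nat \<Rightarrow> nat"
  assumes "l \<ge> 4" and "\<tau> > 0" and "A \<ge> 2 * real l"
    and "\<alpha> = 3 / 4"
    and "\<beta> = min ((1 - \<alpha>) / (2 * (A + 2))) (\<alpha> / (80 * real l))"
    and "\<And>n. m0 n = nat \<lceil>(1 - real n powr (- \<beta>)) * real n ^ 2 / 6\<rceil>"
  shows "(\<lambda>n. measure_pmf.prob (triple_process l n (m0 n))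
            {hs. \<exists>i\<le>m0 n. hs \<in> good_event l A \<alpha> n i - extension_event l \<alpha> n i})
         \<in> o(\<lambda>n. real n powr (- \<tau>))"
proof -
  define P where "P = small_extension_pairs l"
  define C where "C = 12 / q_min l"
  \<comment> \<open>Each extension gains \<open>n powr (- 13 / 480)\<close>. The power
    \<open>s\<close> has to absorb \<open>n ^ (2 * l)\<close> choices of \<open>\<rho>\<close> and
    \<open>n powr \<tau>\<close>, with one more factor \<open>n\<close> to spare for the
    little-o.\<close>
  define s where "s = nat \<lceil>(\<tau> + 2 * real l + 1) * 480 / 13\<rceil>"
  define b where "b = 2 ^ (2 * (2 * l)) * real (3 * (2 * l) * s + 1) ^ (2 * l) * C ^ (2 * l)"
  \<comment> \<open>With \<open>\<beta> * l \<le> \<alpha> / 80 = 3 / 320\<close> the loss is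
    \<open>6 * l * \<beta> \<le> 27 / 480\<close>, against
    \<open>\<alpha> / 9 = 40 / 480\<close>.\<close>
  have \<beta>: "0 \<le> \<beta>" "3 * \<beta> * real (2 * l) - \<alpha> / 9 \<le> - 13 / 480"
  proof -
    show "0 \<le> \<beta>" using assms by simp
    have "\<beta> \<le> \<alpha> / (80 * real l)" unfolding assms(5) by (rule min.cobounded2)
    then have "\<beta> * real l \<le> 3 / 320" using assms(1,4) by (simp add: field_simps)
    then show "3 * \<beta> * real (2 * l) - \<alpha> / 9 \<le> - 13 / 480" using assms(4) by simp
  qed
  have C: "1 \<le> C" using q_min_bounds[of l] by (simp add: C_def field_simps)
  have b: "0 \<le> b" using C by (simp add: b_def)
  have finP: "finite P" unfolding P_def by (rule finite_small_extension_pairs)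
  have s: "real (2 * l) - 13 / 480 * real s \<le> - \<tau> - 1"
  proof -
    have "(\<tau> + 2 * real l + 1) * 480 / 13 \<le> real s" unfolding s_def by linarith
    then show ?thesis by simp
  qed
  let ?bad = "\<lambda>n. {hs. \<exists>i\<le>m0 n. hs \<in> good_event l A \<alpha> n i - extension_event l \<alpha> n i}"
  have bound: "measure_pmf.prob (triple_process l n (m0 n)) (?bad n)
      \<le> real (card P) * b ^ s * real n powr (- \<tau> - 1)" if n: "1 \<le> n" for n
  proof -
    \<comment> \<open>This is the reciprocal of the lower bound on available triples. Over at most
      \<open>n ^ 2\<close> steps it accumulates to \<open>C * n powr (3 * \<beta> - 1)\<close>, so
      \<open>\<gamma> = 3 * \<beta>\<close> below.\<close>
    define r where "r = C * real n powr (3 * \<beta> - 3)"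
    let ?M = "triple_process l n (m0 n)"
    let ?I = "SIGMA GH:P. injections (verts (fst GH)) {1..n}"
    \<comment> \<open>The time \<open>i\<close> is quantified inside the event, so the union runs
      only over pairs and roots.\<close>
    let ?E = "\<lambda>G H \<rho>. {hs. \<exists>i<length hs. (\<forall>j<i. 1 \<le> r * real (card (available l n (hs ! j)))) \<and>
         real n powr (\<alpha> / 9) * extension_scale n G H < real (extension_count n (hs ! i) \<rho> G H)}"
    let ?F = "\<lambda>k. ?E (fst (fst k)) (snd (fst k)) (snd k)"
    have r: "0 \<le> r" using C by (simp add: r_def)
    have m0: "real (m0 n) \<le> real n ^ 2"
    proof -
      have "(1 - real n powr (- \<beta>)) * real n ^ 2 \<le> 1 * real n ^ 2"
        by (intro mult_right_mono) auto
      moreover have "0 \<le> real n ^ 2" by simp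
      ultimately have "(1 - real n powr (- \<beta>)) * real n ^ 2 / 6 \<le> real n ^ 2" by linarith
      then have "(1 - real n powr (- \<beta>)) * real n ^ 2 / 6 \<le> real_of_int (int (n ^ 2))" by simp
      then have "\<lceil>(1 - real n powr (- \<beta>)) * real n ^ 2 / 6\<rceil> \<le> int (n ^ 2)"
        by (simp only: ceiling_le_iff)
      then have "m0 n \<le> n ^ 2" unfolding assms(6) by linarith
      then show ?thesis by (metis of_nat_le_iff of_nat_power)
    qed
    have "real (m0 n) * r \<le> real n ^ 2 * r" using m0 r by (intro mult_right_mono)
    also have "\<dots> = C * (real n powr 2 * real n powr (3 * \<beta> - 3))"
      using n by (simp add: r_def)
    also have "\<dots> = C * real n powr (3 * \<beta> - 1)"
      unfolding powr_add[symmetric] by simp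
    finally have mr: "real (m0 n) * r \<le> C * real n powr (3 * \<beta> - 1)" .
    have finV: "finite (verts G)" "v_num G \<le> 2 * l" if "(G, H) \<in> P" for G H
    proof -
      have "subhypergraph G H" "v_num H \<le> 2 * l"
        using that by (auto simp: P_def small_extension_pairs_def extension_pairs_def)
      then show "finite (verts G)" "v_num G \<le> 2 * l"
        using uniform3_finite card_mono[of "verts H" "verts G"]
        by (fastforce simp: subhypergraph_def)+
    qed
    have finI: "finite ?I" using finP finV by (intro finite_SigmaI finite_injections) auto
    have sub: "?bad n \<subseteq> (\<Union>k\<in>?I. ?F k)"
    proof
      fix hs assume "hs \<in> ?bad n"
      then obtain i where i: "i \<le> m0 n" "hs \<in> good_event l A \<alpha> n i" "hs \<notin> extension_event l \<alpha> n i"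
        by blast
      have len: "i < length hs" using i(2) by (simp add: good_event_def)
      then have "\<not> extension_bounded l \<alpha> n (hs ! i)" using i(3) by (simp add: extension_event_def)
      then obtain G H \<rho> where k: "(G, H) \<in> P" "\<rho> \<in> injections (verts G) {1..n}"
        "real n powr (\<alpha> / 9) * extension_scale n G H < real (extension_count n (hs ! i) \<rho> G H)"
        unfolding P_def by (rule not_extension_boundedE)
      have "1 \<le> r * real (card (available l n (hs ! j)))" if "j < i" for j
        unfolding r_def C_def using i(1) assms(6)
        by (intro good_event_card_available[OF i(2) that n]) simp
      then have "hs \<in> ?F ((G, H), \<rho>)" using len k(3) by auto
      then show "hs \<in> (\<Union>k\<in>?I. ?F k)" using k(1,2) by (intro UN_I[of "((G, H), \<rho>)"]) auto
    qed
    have each: "measure_pmf.prob ?M (?F k) \<le> b ^ s * real n powr (- (13 / 480) * real s)"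
      if k: "k \<in> ?I" for k
    proof -
      obtain G H \<rho> where k': "k = ((G, H), \<rho>)" "(G, H) \<in> P" using k by auto
      then have GH: "subhypergraph G H" "v_num H \<le> 2 * l" "e_num H \<le> 2 * l"
        by (auto simp: P_def small_extension_pairs_def extension_pairs_def)
      have "measure_pmf.prob ?M (?E G H \<rho>) \<le> (b * real n powr (3 * \<beta> * real (2 * l) - \<alpha> / 9)) ^ s"
        using prob_large_extension_count[OF GH n C _ r mr, of l "\<alpha> / 9" \<rho> s] \<beta>(1)
        unfolding b_def by simp
      also have "\<dots> \<le> (b * real n powr (- (13 / 480))) ^ s"
        using b n \<beta>(2) by (intro power_mono mult_left_mono powr_mono) auto
      also have "\<dots> = b ^ s * real n powr (- (13 / 480) * real s)"
        using n by (simp add: power_mult_distrib powr_power mult.commute)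
      finally show ?thesis using k'(1) by simp
    qed
    have "card ?I = (\<Sum>GH\<in>P. card (injections (verts (fst GH)) {1..n}))"
      using finP finV by (intro card_SigmaI ballI finite_injections) auto
    also have "\<dots> \<le> (\<Sum>GH\<in>P. n ^ (2 * l))"
    proof (rule sum_mono)
      fix GH assume "GH \<in> P"
      then have GH: "finite (verts (fst GH))" "v_num (fst GH) \<le> 2 * l"
        using finV[of "fst GH" "snd GH"] by auto
      have "card (injections (verts (fst GH)) {1..n}) \<le> n ^ v_num (fst GH)"
        using finite_injections(2)[OF GH(1), of "{1..n}"] by simp
      also have "\<dots> \<le> n ^ (2 * l)" using n GH(2) by (intro power_increasing) auto
      finally show "card (injections (verts (fst GH)) {1..n}) \<le> n ^ (2 * l)" .
    qed
    finally have "card ?I \<le> card P * n ^ (2 * l)" by simp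
    then have "real (card ?I) \<le> real (card P * n ^ (2 * l))" by (simp only: of_nat_le_iff)
    also have "\<dots> = real (card P) * real n powr real (2 * l)"
      using n by (subst powr_realpow) auto
    finally have cI: "real (card ?I) \<le> real (card P) * real n powr real (2 * l)" .
    have "measure_pmf.prob ?M (?bad n) \<le> measure_pmf.prob ?M (\<Union>k\<in>?I. ?F k)"
      using sub by (intro measure_pmf.finite_measure_mono) auto
    also have "\<dots> \<le> (\<Sum>k\<in>?I. measure_pmf.prob ?M (?F k))"
      using finI by (intro measure_pmf.finite_measure_subadditive_finite) auto
    also have "\<dots> \<le> real (card ?I) * (b ^ s * real n powr (- (13 / 480) * real s))"
      by (intro sum_bounded_above each)
    also have "\<dots> \<le> real (card P) * real n powr real (2 * l) * (b ^ s * real n powr (- (13 / 480) * real s))"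
      using b by (intro mult_right_mono cI) auto
    also have "\<dots> = real (card P) * b ^ s * real n powr (real (2 * l) - 13 / 480 * real s)"
      by (simp add: powr_add[symmetric])
    also have "\<dots> \<le> real (card P) * b ^ s * real n powr (- \<tau> - 1)"
      using b n s by (intro mult_left_mono powr_mono) auto
    finally show ?thesis .
  qed
  have "(\<lambda>n. measure_pmf.prob (triple_process l n (m0 n)) (?bad n)) \<in> O(\<lambda>n. real n powr (- \<tau> - 1))"
    using bound by (intro bigoI[of _ "real (card P) * b ^ s"] eventually_sequentiallyI[of 1]) auto
  also have "(\<lambda>n. real n powr (- \<tau> - 1)) \<in> o(\<lambda>n. real n powr (- \<tau>))"
    by real_asymp
  finally show ?thesis .
qed

end
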